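(* For all $z\in\mathbb{C}\setminus[0,\infty)$ with $\mathrm{Im}(z)\ge 0$, $$\gamma\!\left(\frac1z\right)=z^3\gamma(z)-\pi i z+z^2\log(1-z)-z\log\frac{z-1}{z}+z(1-z)\left[\gamma+\log 2\pi+\frac{\pi i}{2}+\psi\!\left(\frac{\log z}{2\pi i}\right)\right],$$ where $\gamma=\gamma(1)$ is Euler's constant and $\psi=\Gamma'/\Gamma$ is the digamma function.
   Context: $\gamma(z)$ is the generalized-Euler-constant function: for $|z|\le1$, $\gamma(z)=\sum_{n=1}^{\infty} z^{n-1}\left(\frac{1}{n}-\log\frac{n+1}{n}\right)$, and for $z\in\mathbb{C}\setminus[1,\infty)$ it denotes the analytic continuation $\gamma(z)=\int_0^1\frac{1-x+\log x}{(1-xz)\log x}\,dx$. For $z\ne0$, $\log z=\ln|z|+i\,\mathrm{Arg}\,z$ with $-\pi<\mathrm{Arg}\,z\le\pi$. *)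

theory Defs
  imports "HOL-Analysis.Analysis"
begin

text \<open>Generalized-Euler-constant function gamma(z): the power series for norm z \<le> 1,
  and the integral representation (analytic continuation) otherwise, for z outside [1,\<infinity>).\<close>
definition gen_euler :: "complex \<Rightarrow> complex" where
  "gen_euler z =
     (if norm z \<le> 1
      then (\<Sum>n. z ^ n * (1 / of_nat (Suc n) - of_real (ln (real (Suc n + 1) / real (Suc n)))))
      else integral {0..1::real}
             (\<lambda>x. of_real (1 - x + ln x) / ((1 - of_real x * z) * of_real (ln x))))"

end

theory Submission
  imports Defs "HOL-Complex_Analysis.Complex_Analysis"
begin

text \<open>
  Write \<open>k x = (x - 1) / ln x\<close> and \<open>K z = \<integral>\<^sub>0\<^sup>1 k x / (1 - x z) dx\<close>, so that
  \<open>z \<gamma>(z) = - log (1 - z) - z K z\<close> off \<open>[1,\<infinity>)\<close>. The logarithms cancel, and the claim becomes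
  \<open>z\<^sup>2 K z - K (1/z) / z = - \<pi> i + (1 - z) (\<gamma> + log 2\<pi> + \<pi> i / 2 + \<psi> w)\<close> with \<open>z = exp (2 \<pi> i w)\<close>,
  both sides being holomorphic in the strip \<open>0 < Re w < 1\<close>. By the identity theorem it is enough to
  treat rational \<open>w = p/q\<close>. There \<open>z\<close> is a root of unity: summation by parts and Gauss's product for
  \<open>\<Gamma>\<close> express \<open>K z\<close> and \<open>K (1/z)\<close> through the values \<open>log \<Gamma>(r/q)\<close>, which the reflection formula
  combines into \<open>log sin (\<pi> r/q)\<close>, and Gauss's formula for \<open>\<psi>(p/q)\<close> is a finite sum of the same
  logarithms.
\<close>

subsection \<open>The kernel and its moments\<close>

text \<open>The function \<open>k\<close> of the overview, the logarithmic mean of \<open>1\<close>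
  and \<open>x\<close>. The values at \<open>0\<close> and \<open>1\<close> are its one-sided limits
  there, so that it is continuous on the closed interval; the bare quotient would evaluate to
  \<open>0\<close> at \<open>x = 1\<close>.\<close>

definition log_mean_kernel :: "real \<Rightarrow> real" where
  "log_mean_kernel x = (if x = 0 then 0 else if x = 1 then 1 else (x - 1) / ln x)"

lemma continuous_on_log_mean_kernel: "continuous_on {0..1} log_mean_kernel"
  unfolding continuous_on_def
proof
  fix x :: real assume x: "x \<in> {0..1}"
  let ?f = "\<lambda>x::real. (x - 1) / ln x"
  consider "x = 0" | "x = 1" | "0 < x" "x < 1"
    using x by fastforce
  then show "(log_mean_kernel \<longlongrightarrow> log_mean_kernel x) (at x within {0..1})"
  proof cases
    case 1
    have "(?f \<longlongrightarrow> 0) (at_right 0)"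
      by real_asymp
    moreover have "eventually (\<lambda>x. ?f x = log_mean_kernel x) (at_right 0)"
      by (auto simp: log_mean_kernel_def eventually_at intro!: exI[of _ 1])
    ultimately have "(log_mean_kernel \<longlongrightarrow> 0) (at_right 0)"
      by (rule Lim_transform_eventually)
    with 1 show ?thesis
      by (simp add: log_mean_kernel_def at_within_Icc_at_right)
  next
    case 2
    have "(?f \<longlongrightarrow> 1) (at_left 1)"
      by real_asymp
    moreover have "eventually (\<lambda>x. ?f x = log_mean_kernel x) (at_left 1)"
      by (auto simp: log_mean_kernel_def eventually_at intro!: exI[of _ "1/2"])
    ultimately have "(log_mean_kernel \<longlongrightarrow> 1) (at_left 1)"
      by (rule Lim_transform_eventually)
    with 2 show ?thesis
      by (simp add: log_mean_kernel_def at_within_Icc_at_left)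
  next
    case 3
    have "(?f \<longlongrightarrow> ?f x) (at x)"
      using 3 by (intro tendsto_intros) auto
    moreover have "eventually (\<lambda>y. y \<in> {0<..<1}) (at x)"
      using 3 by (intro eventually_at_in_open') auto
    then have "eventually (\<lambda>x. ?f x = log_mean_kernel x) (at x)"
      by eventually_elim (auto simp: log_mean_kernel_def)
    ultimately have "(log_mean_kernel \<longlongrightarrow> ?f x) (at x)"
      by (rule Lim_transform_eventually)
    with 3 show ?thesis
      by (auto simp: log_mean_kernel_def intro: tendsto_within_subset)
  qed
qed

text \<open>Integrating \<open>x powr u\<close> over the exponent \<open>u\<close> produces the
  factor \<open>1 / ln x\<close>. This trades the logarithm in the kernel for a second integration
  and prepares an exchange of integrals.\<close>

lemma integral_powr_exponent:
  fixes x :: real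
  assumes "0 \<le> x" "x \<le> 1" "0 < n"
  shows "integral {0..1} (\<lambda>u. x powr (real n + u)) = x ^ n * log_mean_kernel x"
proof -
  consider "x = 0" | "x = 1" | "0 < x" "x < 1"
    using assms by fastforce
  then show ?thesis
  proof cases
    case 3
    then have "((\<lambda>u. exp ((real n + u) * ln x) / ln x) has_real_derivative exp ((real n + u) * ln x))
        (at u within {0..1})" for u
      by (auto intro!: derivative_eq_intros)
    then have "((\<lambda>u. exp ((real n + u) * ln x)) has_integral
            exp ((real n + 1) * ln x) / ln x - exp ((real n + 0) * ln x) / ln x) {0..1}"
      by (intro fundamental_theorem_of_calculus)
         (auto simp flip: has_real_derivative_iff_has_vector_derivative)
    with 3 have "((\<lambda>u. x powr (real n + u)) has_integral
            x powr (real n + 1) / ln x - x powr (real n + 0) / ln x) {0..1}"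
      by (simp add: powr_def)
    then have "integral {0..1} (\<lambda>u. x powr (real n + u))
        = x powr (real n + 1) / ln x - x powr (real n + 0) / ln x"
      by (rule integral_unique)
    also have "\<dots> = x ^ n * log_mean_kernel x"
      using 3 by (simp add: log_mean_kernel_def powr_add powr_realpow field_simps)
    finally show ?thesis .
  qed (use assms in \<open>auto simp: log_mean_kernel_def\<close>)
qed

text \<open>Fubini: integrating over \<open>x\<close> first leaves \<open>1 / (n + u + 1)\<close>,
  whose integral over \<open>u\<close> is a logarithm. A positive \<open>n\<close> keeps the
  exponent \<open>n + u\<close> positive, so the integrand is continuous on the whole closed square,
  including the edge \<open>x = 0\<close>.\<close>

lemma log_mean_kernel_moment_pos:
  assumes "0 < n"
  shows "integral {0..1} (\<lambda>x. x ^ n * log_mean_kernel x) = ln (real (n + 2) / real (n + 1))"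
proof -
  have cont: "continuous_on (cbox (0, 0) (1, 1)) (\<lambda>(u, x). x powr (real n + u))"
    using assms unfolding case_prod_unfold
    by (intro continuous_on_powr' continuous_intros) (auto simp: cbox_Pair_eq)
  have inner: "integral {0..1} (\<lambda>x. x powr (real n + u)) = 1 / (real n + u + 1)"
    if "u \<in> {0..1}" for u :: real
    using has_integral_powr_from_0[of "real n + u" 1] that by (simp add: integral_unique)
  have "integral {0..1} (\<lambda>x. x ^ n * log_mean_kernel x)
      = integral {0..1} (\<lambda>x. integral {0..1} (\<lambda>u. x powr (real n + u)))"
    using assms by (intro integral_cong) (simp add: integral_powr_exponent)
  also have "\<dots> = integral {0..1} (\<lambda>u. integral {0..1} (\<lambda>x. x powr (real n + u)))"
    using integral_swap_continuous[OF cont] by simp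
  also have "\<dots> = integral {0..1} (\<lambda>u. 1 / (real n + u + 1))"
    by (intro integral_cong inner)
  also have "((\<lambda>u. 1 / (real n + u + 1)) has_integral ln (real n + 1 + 1) - ln (real n + 0 + 1)) {0..1}"
    by (intro fundamental_theorem_of_calculus)
       (auto intro!: derivative_eq_intros simp flip: has_real_derivative_iff_has_vector_derivative)
  then have "integral {0..1} (\<lambda>u. 1 / (real n + u + 1)) = ln (real (n + 2) / real (n + 1))"
    by (simp add: integral_unique ln_div add_ac)
  finally show ?thesis .
qed

lemma log_mean_kernel_moment:
  "integral {0..1} (\<lambda>x. x ^ n * log_mean_kernel x) = ln (real (n + 2) / real (n + 1))"
proof (cases "n = 0")
  case True
  \<comment> \<open>the substitution \<open>x = y\<^sup>2\<close> reduces the case \<open>n = 0\<close> to the moments of order 1 and 2\<close>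
  have int: "(\<lambda>x. x ^ m * log_mean_kernel x) integrable_on {0..1}" for m
    by (intro integrable_continuous_real continuous_intros continuous_on_log_mean_kernel)
  have "((\<lambda>y. (2 * y) *\<^sub>R log_mean_kernel (y\<^sup>2)) has_integral
          integral {0\<^sup>2..1\<^sup>2} log_mean_kernel) {0..1}"
    by (rule has_integral_substitution[where c = 0 and d = 1])
       (auto intro!: derivative_eq_intros continuous_on_log_mean_kernel simp: power_le_one)
  then have "integral {0..1} log_mean_kernel = integral {0..1} (\<lambda>y. 2 * y * log_mean_kernel (y\<^sup>2))"
    by (simp add: integral_unique)
  \<comment> \<open>Since \<open>y^2 - 1 = (y - 1) * (y + 1)\<close> and
    \<open>ln (y^2) = 2 * ln y\<close>, the integrand is \<open>y * (y + 1)\<close> times the kernel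
    at \<open>y\<close>.\<close>
  also have "\<dots> = integral {0..1} (\<lambda>y. y ^ 1 * log_mean_kernel y + y ^ 2 * log_mean_kernel y)"
  proof (intro integral_cong)
    fix y :: real assume y: "y \<in> {0..1}"
    consider "y = 0" | "y = 1" | "0 < y" "y < 1"
      using y by fastforce
    then show "2 * y * log_mean_kernel (y\<^sup>2) = y ^ 1 * log_mean_kernel y + y ^ 2 * log_mean_kernel y"
    proof cases
      case 3
      then have "y\<^sup>2 \<noteq> 1" and "ln y \<noteq> 0" and "ln (y\<^sup>2) = 2 * ln y"
        by (auto simp: power2_eq_1_iff ln_realpow)
      with 3 show ?thesis
        unfolding log_mean_kernel_def by (simp add: field_simps) (simp add: algebra_simps power2_eq_square)
    qed (auto simp: log_mean_kernel_def)
  qed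
  also have "\<dots> = ln (3 / 2) + ln (4 / 3)"
    using int[of 1] int[of 2] log_mean_kernel_moment_pos[of 1] log_mean_kernel_moment_pos[of 2]
    by (subst integral_add) (simp_all add: power2_eq_square)
  also have "\<dots> = ln (real (n + 2) / real (n + 1))"
    using True by (simp add: ln_div) (use ln_realpow[of 2 2] in simp)
  finally show ?thesis
    using True by simp
qed (simp add: log_mean_kernel_moment_pos)

subsection \<open>The integral transform of the kernel\<close>

lemma one_minus_real_mult_nonzero:
  fixes z :: complex
  assumes "z \<notin> complex_of_real ` {1..}" "0 \<le> x" "x \<le> 1"
  shows "1 - of_real x * z \<noteq> 0"
proof
  assume "1 - of_real x * z = 0"
  then have "x \<noteq> 0" and "of_real x * z = 1"
    by auto
  then have "z = of_real (1 / x)"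
    by (simp add: nonzero_eq_divide_eq mult.commute)
  moreover have "1 / x \<ge> 1"
    using assms \<open>x \<noteq> 0\<close> by (simp add: field_simps)
  ultimately show False
    using assms(1) by (metis atLeast_iff image_eqI)
qed

lemma integral_power_01: "integral {0..1::real} (\<lambda>x. x ^ n) = 1 / real (n + 1)"
proof -
  have "((\<lambda>x. x ^ n) has_integral 1 ^ Suc n / real (Suc n) - 0 ^ Suc n / real (Suc n)) {0..1::real}"
    by (intro fundamental_theorem_of_calculus)
       (auto intro!: derivative_eq_intros simp del: power_Suc simp flip: has_real_derivative_iff_has_vector_derivative)
  then show ?thesis
    by (simp add: integral_unique)
qed

text \<open>Expand the resolvent as a geometric series under the integral. For
  \<open>norm z = 1\<close> the ratio \<open>x * z\<close> is not uniformly below 1 in norm, but the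
  remainder is at most the integral of \<open>B * x ^ N\<close>, which still tends to 0. Hence every
  boundary point except \<open>1\<close> is covered, in particular the roots of unity needed
  later.\<close>

lemma sums_integral_resolvent:
  fixes z :: complex and g :: "real \<Rightarrow> real"
  assumes g: "continuous_on {0..1} g" and z: "norm z \<le> 1" "z \<noteq> 1"
  shows "(\<lambda>n. z ^ n * of_real (integral {0..1} (\<lambda>x. x ^ n * g x))) sums
           integral {0..1} (\<lambda>x. of_real (g x) / (1 - of_real x * z))"
proof -
  have z': "z \<notin> complex_of_real ` {1..}"
    using z by auto
  define h where "h = (\<lambda>x. of_real (g x) / (1 - of_real x * z))"
  have h: "continuous_on {0..1} h"
    unfolding h_def using one_minus_real_mult_nonzero[OF z']
    by (intro continuous_intros g) auto
  have "compact (h ` {0..1})"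
    by (intro compact_continuous_image h) simp
  then obtain B where B: "\<And>x. x \<in> {0..1} \<Longrightarrow> norm (h x) \<le> B"
    by (metis compact_imp_bounded bounded_iff image_eqI)
  have int: "(\<lambda>x. (of_real x * z) ^ n * h x) integrable_on {0..1}" for n
    by (intro integrable_continuous_real continuous_intros h)
  have coeff: "z ^ n * of_real (integral {0..1} (\<lambda>x. x ^ n * g x))
      = integral {0..1} (\<lambda>x. (of_real x * z) ^ n * of_real (g x))" for n
  proof -
    have "integral {0..1} (\<lambda>x. (of_real x * z) ^ n * of_real (g x))
        = integral {0..1} (\<lambda>x. z ^ n * complex_of_real (x ^ n * g x))"
      by (intro integral_cong) (simp add: power_mult_distrib)
    also have "\<dots> = z ^ n * integral {0..1} (\<lambda>x. complex_of_real (x ^ n * g x))"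
      by simp
    also have "integral {0..1} (\<lambda>x. complex_of_real (x ^ n * g x))
        = of_real (integral {0..1} (\<lambda>x. x ^ n * g x))"
      using g by (intro integral_unique has_integral_of_real integrable_integral
          integrable_continuous_real continuous_intros)
    finally show ?thesis by simp
  qed
  have partial: "(\<Sum>n<N. z ^ n * of_real (integral {0..1} (\<lambda>x. x ^ n * g x)))
      = integral {0..1} h - integral {0..1} (\<lambda>x. (of_real x * z) ^ N * h x)" for N
  proof -
    have "(\<Sum>n<N. z ^ n * of_real (integral {0..1} (\<lambda>x. x ^ n * g x)))
        = integral {0..1} (\<lambda>x. \<Sum>n<N. (of_real x * z) ^ n * of_real (g x))"
      unfolding coeff using g
      by (intro integral_sum[symmetric] integrable_continuous_real continuous_intros) auto
    also have "\<dots> = integral {0..1} (\<lambda>x. h x - (of_real x * z) ^ N * h x)"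
    proof (intro integral_cong)
      fix x :: real assume "x \<in> {0..1}"
      then have "1 - of_real x * z \<noteq> 0"
        using one_minus_real_mult_nonzero[OF z'] by simp
      moreover have "(1 - of_real x * z) * (\<Sum>n<N. (of_real x * z) ^ n) = 1 - (of_real x * z) ^ N"
        by (rule one_diff_power_eq[symmetric])
      ultimately have "(\<Sum>n<N. (of_real x * z) ^ n) = (1 - (of_real x * z) ^ N) / (1 - of_real x * z)"
        by (metis nonzero_mult_div_cancel_left)
      then show "(\<Sum>n<N. (of_real x * z) ^ n * of_real (g x)) = h x - (of_real x * z) ^ N * h x"
        by (simp add: h_def left_diff_distrib diff_divide_distrib flip: sum_distrib_right)
    qed
    also have "\<dots> = integral {0..1} h - integral {0..1} (\<lambda>x. (of_real x * z) ^ N * h x)"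
      using int[of 0] int[of N] by (simp add: integral_diff)
    finally show ?thesis .
  qed
  have bound: "norm (integral {0..1} (\<lambda>x. (of_real x * z) ^ N * h x)) \<le> B / real (N + 1)" for N
  proof -
    have "norm (integral {0..1} (\<lambda>x. (of_real x * z) ^ N * h x)) \<le> integral {0..1} (\<lambda>x. x ^ N * B)"
    proof (intro integral_norm_bound_integral int)
      fix x :: real assume x: "x \<in> {0..1}"
      have "norm ((of_real x * z) ^ N * h x) = x ^ N * norm z ^ N * norm (h x)"
        using x by (simp add: norm_mult norm_power power_mult_distrib)
      also have "\<dots> \<le> x ^ N * 1 * B"
        using x z B[OF x] by (intro mult_mono) (auto simp: power_le_one)
      finally show "norm ((of_real x * z) ^ N * h x) \<le> x ^ N * B" by simp
    qed (intro integrable_continuous_real continuous_intros)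
    also have "\<dots> = B / real (N + 1)"
      using integral_power_01[of N] by simp
    finally show ?thesis .
  qed
  have "(\<lambda>N. B / real (N + 1)) \<longlonglongrightarrow> 0"
    by real_asymp
  then have "(\<lambda>N. integral {0..1} (\<lambda>x. (of_real x * z) ^ N * h x)) \<longlonglongrightarrow> 0"
    by (rule Lim_null_comparison[rotated]) (use bound in auto)
  then have "(\<lambda>N. integral {0..1} h - integral {0..1} (\<lambda>x. (of_real x * z) ^ N * h x))
      \<longlonglongrightarrow> integral {0..1} h - 0"
    by (intro tendsto_intros)
  then show ?thesis
    by (simp add: sums_def partial h_def)
qed

text \<open>An antiderivative in \<open>x\<close> is \<open>- Ln (1 - x * z)\<close>: the segment
  traced by \<open>1 - x * z\<close> meets the branch cut of \<open>Ln\<close> only if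
  \<open>z\<close> is real and at least 1.\<close>

lemma integral_resolvent_eq_Ln:
  fixes z :: complex
  assumes "z \<notin> complex_of_real ` {1..}"
  shows "z * integral {0..1} (\<lambda>x. 1 / (1 - of_real x * z)) = - Ln (1 - z)"
proof -
  have "((\<lambda>x. z / (1 - of_real x * z)) has_integral
          - Ln (1 - of_real 1 * z) - (- Ln (1 - of_real 0 * z))) {0..1}"
  proof (intro fundamental_theorem_of_calculus)
    fix x :: real assume x: "x \<in> {0..1}"
    have "1 - of_real x * z \<notin> \<real>\<^sub>\<le>\<^sub>0"
    proof
      assume "1 - of_real x * z \<in> \<real>\<^sub>\<le>\<^sub>0"
      then obtain r where r: "1 - of_real x * z = of_real r" "r \<le> 0"
        by (auto elim!: nonpos_Reals_cases)
      then have "x \<noteq> 0" and "of_real x * z = of_real (1 - r)"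
        by (auto simp: algebra_simps)
      then have "z = of_real ((1 - r) / x)"
        by (simp add: nonzero_eq_divide_eq mult.commute)
      moreover have "(1 - r) / x \<ge> 1"
        using x r \<open>x \<noteq> 0\<close> by (auto simp: field_simps)
      ultimately show False
        using assms by (metis atLeast_iff image_eqI)
    qed
    then have "((\<lambda>w. - Ln (1 - w * z)) has_field_derivative z / (1 - of_real x * z)) (at (of_real x))"
      by (auto intro!: derivative_eq_intros simp: field_simps)
    then show "((\<lambda>x. - Ln (1 - of_real x * z)) has_vector_derivative z / (1 - of_real x * z))
        (at x within {0..1})"
      by (intro has_vector_derivative_real_field has_vector_derivative_at_within)
  qed simp
  then have "integral {0..1} (\<lambda>x. z * (1 / (1 - of_real x * z))) = - Ln (1 - z)"
    by (simp add: integral_unique)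
  then show ?thesis
    by (simp only: integral_mult_right)
qed

text \<open>The function \<open>K\<close> of the overview.\<close>

definition log_mean_transform :: "complex \<Rightarrow> complex" where
  "log_mean_transform z = integral {0..1} (\<lambda>x. of_real (log_mean_kernel x) / (1 - of_real x * z))"

lemma log_mean_transform_sums:
  assumes "norm z \<le> 1" "z \<noteq> 1"
  shows "(\<lambda>n. z ^ n * of_real (ln (real (n + 2) / real (n + 1)))) sums log_mean_transform z"
  using sums_integral_resolvent[OF continuous_on_log_mean_kernel assms]
  by (simp add: log_mean_kernel_moment log_mean_transform_def)

text \<open>The resolvent expansion for the constant function 1; it yields the logarithmic series on
  the unit circle too, without a separate appeal to Abel's theorem.\<close>

lemma Ln_one_minus_sums:
  assumes "norm z \<le> 1" "z \<noteq> 1"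
  shows "(\<lambda>n. z ^ (n + 1) / of_nat (n + 1)) sums (- Ln (1 - z))"
proof -
  have z: "z \<notin> complex_of_real ` {1..}"
    using assms by auto
  have "(\<lambda>n. z ^ n / of_nat (n + 1)) sums integral {0..1} (\<lambda>x. 1 / (1 - of_real x * z))"
    using sums_integral_resolvent[of "\<lambda>_. 1", OF _ assms] by (simp add: integral_power_01 add.commute)
  from sums_mult[OF this, of z] show ?thesis
    by (simp add: integral_resolvent_eq_Ln[OF z])
qed

text \<open>Merges the two branches of the definition. In the closed disc the coefficients of the
  series are the moments of \<open>1 - log_mean_kernel x\<close>; outside it the two integrands
  agree except at the endpoints, a null set.\<close>

lemma gen_euler_eq:
  assumes "z \<notin> complex_of_real ` {1..}"
  shows "gen_euler z = integral {0..1} (\<lambda>x. of_real (1 - log_mean_kernel x) / (1 - of_real x * z))"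
proof (cases "norm z \<le> 1")
  case True
  have "z \<noteq> 1"
    using assms by auto
  have 1: "continuous_on {0..1} (\<lambda>x. 1 - log_mean_kernel x)"
    by (intro continuous_intros continuous_on_log_mean_kernel)
  have 2: "integral {0..1} (\<lambda>x. x ^ n * (1 - log_mean_kernel x))
      = 1 / real (Suc n) - ln (real (Suc n + 1) / real (Suc n))" for n
  proof -
    have "integral {0..1} (\<lambda>x. x ^ n * (1 - log_mean_kernel x))
        = integral {0..1} (\<lambda>x. x ^ n) - integral {0..1} (\<lambda>x. x ^ n * log_mean_kernel x)"
      unfolding right_diff_distrib mult_1_right
      by (intro integral_diff integrable_continuous_real continuous_intros continuous_on_log_mean_kernel)
    then show ?thesis
      by (simp add: integral_power_01 log_mean_kernel_moment add_ac)
  qed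
  show ?thesis
    using sums_unique[OF sums_integral_resolvent[OF 1 True \<open>z \<noteq> 1\<close>]] True
    unfolding gen_euler_def 2 by simp
next
  case False
  have "integral {0..1} (\<lambda>x. of_real (1 - x + ln x) / ((1 - of_real x * z) * of_real (ln x)))
      = integral {0..1} (\<lambda>x. of_real (1 - log_mean_kernel x) / (1 - of_real x * z))"
  proof (rule integral_spike[of "{0, 1}"])
    fix x :: real assume x: "x \<in> {0..1} - {0, 1}"
    then have "1 - log_mean_kernel x = (1 - x + ln x) / ln x"
      by (simp add: log_mean_kernel_def field_simps)
    then show "of_real (1 - log_mean_kernel x) / (1 - of_real x * z)
        = of_real (1 - x + ln x) / ((1 - of_real x * z) * of_real (ln x))"
      by (simp only: of_real_divide divide_divide_eq_left mult.commute)
  qed simp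
  with False show ?thesis
    by (simp add: gen_euler_def)
qed

lemma gen_euler_conv_log_mean_transform:
  assumes z: "z \<notin> complex_of_real ` {1..}"
  shows "z * gen_euler z = - Ln (1 - z) - z * log_mean_transform z"
proof -
  have "gen_euler z = integral {0..1}
      (\<lambda>x. 1 / (1 - of_real x * z) - of_real (log_mean_kernel x) / (1 - of_real x * z))"
    by (simp add: gen_euler_eq[OF z] diff_divide_distrib)
  also have "\<dots> = integral {0..1} (\<lambda>x. 1 / (1 - of_real x * z)) - log_mean_transform z"
    unfolding log_mean_transform_def using one_minus_real_mult_nonzero[OF z]
    by (intro integral_diff integrable_continuous_real continuous_intros
        continuous_on_log_mean_kernel) auto
  finally show ?thesis
    by (simp add: right_diff_distrib integral_resolvent_eq_Ln[OF z])
qed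

text \<open>Differentiation under the integral sign. It is carried out on small balls because the
  Leibniz rule asks for a convex domain and the slit plane is not convex.\<close>

lemma holomorphic_on_log_mean_transform: "log_mean_transform holomorphic_on - complex_of_real ` {1..}"
proof -
  have "closed (complex_of_real ` {1..})"
    by (intro closed_injective_linear_image_eq[THEN iffD2]) (auto simp: inj_def linear_iff scaleR_conv_of_real)
  then have op: "open (- complex_of_real ` {1..})"
    by auto
  have "\<exists>r>0. log_mean_transform holomorphic_on ball z r" if z: "z \<in> - complex_of_real ` {1..}" for z
  proof -
    obtain r where r: "r > 0" "ball z r \<subseteq> - complex_of_real ` {1..}"
      using op z openE by blast
    have nz: "1 - of_real x * w \<noteq> 0" if "w \<in> ball z r" "x \<in> {0..1}" for w x
      using that subsetD[OF r(2)] by (intro one_minus_real_mult_nonzero) auto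
    have cont: "continuous_on (ball z r \<times> {0..1}) (\<lambda>p. log_mean_kernel (snd p))"
      by (rule continuous_on_compose2[OF continuous_on_log_mean_kernel continuous_on_snd]) auto
    have "(\<lambda>w. integral (cbox 0 1) (\<lambda>x. of_real (log_mean_kernel x) / (1 - of_real x * w)))
        holomorphic_on ball z r"
    proof (rule leibniz_rule_holomorphic[where
          fx = "\<lambda>w x. of_real (log_mean_kernel x) * of_real x / (1 - of_real x * w) ^ 2"])
      show "((\<lambda>w. of_real (log_mean_kernel x) / (1 - of_real x * w)) has_field_derivative
              of_real (log_mean_kernel x) * of_real x / (1 - of_real x * w) ^ 2) (at w within ball z r)"
        if "w \<in> ball z r" "x \<in> cbox 0 1" for w x
        using nz[of w x] that by (auto intro!: derivative_eq_intros simp: power2_eq_square)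
      show "(\<lambda>x. of_real (log_mean_kernel x) / (1 - of_real x * w)) integrable_on cbox 0 1"
        if "w \<in> ball z r" for w
        using nz[of w] that
        by (intro integrable_continuous continuous_intros) (auto intro: continuous_on_log_mean_kernel)
      show "continuous_on (ball z r \<times> cbox 0 1)
              (\<lambda>(w, x). of_real (log_mean_kernel x) * of_real x / (1 - of_real x * w) ^ 2)"
        using nz unfolding case_prod_unfold by (intro continuous_intros) (auto simp: cont)
    qed simp
    then show ?thesis
      using r by (auto simp: log_mean_transform_def[abs_def])
  qed
  then show ?thesis
    unfolding holomorphic_on_open[OF op]
    by (meson centre_in_ball holomorphic_on_open open_ball)
qed

subsection \<open>Values at roots of unity\<close>

text \<open>Sorts the summation indices by their residue modulo \<open>q\<close>, on which alone the
  powers of a \<open>q\<close>-th root of unity depend.\<close>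

lemma sum_lessThan_mult_residues:
  fixes f :: "nat \<Rightarrow> 'a::comm_monoid_add"
  shows "(\<Sum>n<N * q. f n) = (\<Sum>r<q. \<Sum>k<N. f (k * q + r))"
proof -
  have "(\<Sum>n<N * q. f n) = (\<Sum>k<N. \<Sum>n\<in>{k * q..<k * q + q}. f n)"
    by (simp add: sum.nat_group)
  also have "\<dots> = (\<Sum>k<N. \<Sum>r<q. f (k * q + r))"
  proof (rule sum.cong[OF refl])
    fix k
    show "(\<Sum>n\<in>{k * q..<k * q + q}. f n) = (\<Sum>r<q. f (k * q + r))"
      by (rule sum.reindex_bij_witness[of _ "\<lambda>r. k * q + r" "\<lambda>n. n - k * q"]) auto
  qed
  also have "\<dots> = (\<Sum>r<q. \<Sum>k<N. f (k * q + r))"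
    by (rule sum.swap)
  finally show ?thesis .
qed

lemma sum_root_of_unity:
  fixes z :: "'a::field"
  assumes "z ^ q = 1" "z \<noteq> 1"
  shows "(\<Sum>r<q. z ^ r) = 0"
  using assms by (simp add: geometric_sum)

lemma sum_index_root_of_unity:
  fixes z :: "'a::field"
  assumes "z ^ q = 1" "z \<noteq> 1"
  shows "(\<Sum>r<q. of_nat r * z ^ r) = of_nat q / (z - 1)"
proof -
  \<comment> \<open>Holds for every \<open>z\<close> and \<open>n\<close>; the root of unity enters
    only at \<open>n = q\<close>, where \<open>z ^ q = 1\<close> and the last sum vanishes.\<close>
  have "(z - 1) * (\<Sum>r<n. of_nat r * z ^ r) = of_nat n * z ^ n - z * (\<Sum>r<n. z ^ r)" for n
    by (induction n) (simp_all add: algebra_simps)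
  from this[of q] show ?thesis
    using assms by (simp add: sum_root_of_unity nonzero_eq_divide_eq mult.commute)
qed

text \<open>Logarithm of Gauss's product in the variant with \<open>fact (N - 1)\<close>, whose
  denominator has exactly \<open>N\<close> factors. This matches the \<open>N\<close> members of
  each residue class below \<open>N * q\<close>.\<close>

lemma ln_Gamma_real_lim:
  fixes x :: real
  assumes "x > 0"
  shows "(\<lambda>N. ln (fact (N - 1)) + x * ln (real N) - (\<Sum>k<N. ln (real k + x))) \<longlonglongrightarrow> ln (Gamma x)"
proof -
  have "Gamma x \<noteq> 0"
    using Gamma_real_pos[OF assms] by simp
  then have "(\<lambda>N. ln (Gamma_series' x N)) \<longlonglongrightarrow> ln (Gamma x)"
    by (intro tendsto_ln Gamma_series'_LIMSEQ)
  moreover have "eventually (\<lambda>N. ln (Gamma_series' x N)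
      = ln (fact (N - 1)) + x * ln (real N) - (\<Sum>k<N. ln (real k + x))) sequentially"
    using eventually_gt_at_top[of 0]
  proof eventually_elim
    case (elim N)
    have "ln (pochhammer x N) = (\<Sum>k<N. ln (real k + x))"
      using assms by (simp add: pochhammer_prod ln_prod atLeast0LessThan add.commute add_pos_nonneg)
    moreover have "pochhammer x N > 0"
      using assms by (rule pochhammer_pos)
    ultimately show ?case
      by (simp add: Gamma_series'_def ln_div ln_mult)
  qed
  ultimately show ?thesis
    by (rule Lim_transform_eventually)
qed

text \<open>Turns the logarithmic differences in the coefficients of the transform into single
  logarithms. The factor \<open>1 / z - 1\<close> comes from the index shift; with
  \<open>M = N * q\<close> the boundary term loses its power of \<open>z\<close>.\<close>

lemma summation_by_parts_ln:
  fixes z :: complex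
  assumes "z \<noteq> 0"
  shows "(\<Sum>n<M. z ^ (n + 1) * of_real (ln (real (n + 2)) - ln (real (n + 1))))
    = (1 / z - 1) * (\<Sum>n<M. z ^ (n + 1) * of_real (ln (real (n + 1)))) + z ^ M * of_real (ln (real (M + 1)))"
proof (induction M)
  case (Suc M)
  then show ?case
    using assms by (simp add: algebra_simps)
qed simp

lemma strict_mono_mult_right:
  fixes q :: nat
  assumes "q > 0"
  shows "strict_mono (\<lambda>N. N * q)"
  using assms by (simp add: strict_mono_def)

text \<open>Truncate the series at \<open>N * q\<close>, sum by parts and sort by residues: each
  class gives the logarithm of a Gauss product. Growth common to all classes is cancelled by the
  vanishing sum of the powers of \<open>z\<close>. What grows like \<open>ln N\<close> has total
  coefficient \<open>-1\<close> and combines with the boundary term \<open>ln (N * q + 1)\<close> to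
  leave \<open>ln q\<close> in the limit.\<close>

lemma log_mean_transform_root_of_unity:
  fixes z :: complex
  assumes zq: "z ^ q = 1" and z1: "z \<noteq> 1" and q: "q > 0"
  shows "z * log_mean_transform z
    = of_real (ln (real q)) - (1 / z - 1) * (\<Sum>r=1..<q. z ^ r * of_real (ln (Gamma (real r / real q))))"
proof -
  have z0: "z \<noteq> 0"
    using zq q by (auto simp: power_0_left)
  have nz: "norm z = 1"
    using power_eq_imp_eq_norm[of z q 1] zq q by simp
  define g where "g = (\<lambda>r N. ln (fact (N - 1)) + real r / real q * ln (real N)
                               - (\<Sum>k<N. ln (real k + real r / real q)))"
  have g_lim: "g r \<longlonglongrightarrow> ln (Gamma (real r / real q))" if "r > 0" for r
    unfolding g_def using that q by (intro ln_Gamma_real_lim) simp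
  have sum0: "(\<Sum>r<q. z ^ (r + 1)) = 0"
    using sum_root_of_unity[OF zq z1] by (simp flip: sum_distrib_left)
  have sum1: "(\<Sum>r<q. z ^ (r + 1) * of_real (real (r + 1) / real q)) = z / (z - 1)"
  proof -
    have "(\<Sum>r<q. z ^ (r + 1) * of_real (real (r + 1) / real q))
        = z / of_nat q * ((\<Sum>r<q. of_nat r * z ^ r) + (\<Sum>r<q. z ^ r))"
      by (simp add: sum_distrib_left sum.distrib[symmetric] field_simps)
    then show ?thesis
      using q by (simp add: sum_root_of_unity[OF zq z1] sum_index_root_of_unity[OF zq z1])
  qed
  have partial: "z * (\<Sum>n<N * q. z ^ n * of_real (ln (real (n + 2) / real (n + 1))))
      = of_real (ln (real (N * q + 1)) - ln (real N)) - (1 / z - 1) * (\<Sum>r<q. z ^ (r + 1) * of_real (g (r + 1) N))"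
    if N: "N > 0" for N
  proof -
    \<comment> \<open>Pulling \<open>q\<close> out of each term leaves
      \<open>k + (r + 1) / q\<close>, the factors of the Gauss product at
      \<open>(r + 1) / q\<close>.\<close>
    have 1: "(\<Sum>k<N. ln (real (k * q + r + 1)))
        = real N * ln (real q) + ln (fact (N - 1)) + real (r + 1) / real q * ln (real N) - g (r + 1) N" for r
    proof -
      have "(\<Sum>k<N. ln (real (k * q + r + 1))) = (\<Sum>k<N. ln (real q) + ln (real k + real (r + 1) / real q))"
      proof (rule sum.cong[OF refl])
        fix k
        have "real (k * q + r + 1) = real q * (real k + real (r + 1) / real q)"
          using q by (simp add: field_simps)
        moreover have "real k + real (r + 1) / real q > 0"
          using q by (intro add_nonneg_pos) auto
        ultimately show "ln (real (k * q + r + 1)) = ln (real q) + ln (real k + real (r + 1) / real q)"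
          using q by (metis ln_mult_pos of_nat_0_less_iff)
      qed
      then show ?thesis
        by (simp add: sum.distrib g_def)
    qed
    have "(\<Sum>n<N * q. z ^ (n + 1) * of_real (ln (real (n + 1))))
        = (\<Sum>r<q. \<Sum>k<N. z ^ (r + 1) * of_real (ln (real (k * q + r + 1))))"
      unfolding sum_lessThan_mult_residues
      by (intro sum.cong refl) (simp add: power_add power_mult zq mult.commute[of _ q])
    also have "\<dots> = (\<Sum>r<q. z ^ (r + 1) * of_real (\<Sum>k<N. ln (real (k * q + r + 1))))"
      by (simp add: sum_distrib_left)
    also have "\<dots> = (\<Sum>r<q. z ^ (r + 1)) * of_real (real N * ln (real q) + ln (fact (N - 1)))
        + of_real (ln (real N)) * (\<Sum>r<q. z ^ (r + 1) * of_real (real (r + 1) / real q))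
        - (\<Sum>r<q. z ^ (r + 1) * of_real (g (r + 1) N))"
      unfolding 1 sum_distrib_left sum_distrib_right sum.distrib[symmetric] sum_subtractf[symmetric]
      by (intro sum.cong refl) (simp add: algebra_simps)
    finally have 2: "(\<Sum>n<N * q. z ^ (n + 1) * of_real (ln (real (n + 1))))
        = of_real (ln (real N)) * (z / (z - 1)) - (\<Sum>r<q. z ^ (r + 1) * of_real (g (r + 1) N))"
      unfolding sum0 sum1 by simp
    have "z * (\<Sum>n<N * q. z ^ n * of_real (ln (real (n + 2) / real (n + 1))))
        = (\<Sum>n<N * q. z ^ (n + 1) * of_real (ln (real (n + 2)) - ln (real (n + 1))))"
      unfolding sum_distrib_left by (intro sum.cong refl) (simp add: ln_div)
    also have "\<dots> = (1 / z - 1) * (of_real (ln (real N)) * (z / (z - 1))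
        - (\<Sum>r<q. z ^ (r + 1) * of_real (g (r + 1) N))) + of_real (ln (real (N * q + 1)))"
      unfolding summation_by_parts_ln[OF z0] 2
      by (simp add: power_mult zq mult.commute[of N q])
    also have "(1 / z - 1) * (of_real (ln (real N)) * (z / (z - 1))
        - (\<Sum>r<q. z ^ (r + 1) * of_real (g (r + 1) N)))
        = - of_real (ln (real N)) - (1 / z - 1) * (\<Sum>r<q. z ^ (r + 1) * of_real (g (r + 1) N))"
    proof -
      have "(1 / z - 1) * (z / (z - 1)) = - 1"
        using z0 z1 by (simp add: field_simps)
      moreover have "(1 / z - 1) * (of_real (ln (real N)) * (z / (z - 1)) - S)
          = of_real (ln (real N)) * ((1 / z - 1) * (z / (z - 1))) - (1 / z - 1) * S" for S
        by (simp only: right_diff_distrib mult.left_commute)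
      ultimately show ?thesis
        by (simp only: mult_minus1_right)
    qed
    finally show ?thesis
      by simp
  qed
  have "(\<lambda>N. z * (\<Sum>n<N * q. z ^ n * of_real (ln (real (n + 2) / real (n + 1)))))
      \<longlonglongrightarrow> z * log_mean_transform z"
    using LIMSEQ_subseq_LIMSEQ[OF log_mean_transform_sums[of z, unfolded sums_def] strict_mono_mult_right[OF q]] nz z1
    by (intro tendsto_mult_left) (simp_all add: o_def)
  moreover have "eventually (\<lambda>N. z * (\<Sum>n<N * q. z ^ n * of_real (ln (real (n + 2) / real (n + 1))))
      = of_real (ln (real (N * q + 1)) - ln (real N)) - (1 / z - 1) * (\<Sum>r<q. z ^ (r + 1) * of_real (g (r + 1) N)))
      sequentially"
    using eventually_gt_at_top[of 0] by eventually_elim (rule partial)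
  ultimately have "(\<lambda>N. of_real (ln (real (N * q + 1)) - ln (real N))
      - (1 / z - 1) * (\<Sum>r<q. z ^ (r + 1) * of_real (g (r + 1) N))) \<longlonglongrightarrow> z * log_mean_transform z"
    by (rule Lim_transform_eventually)
  moreover have "(\<lambda>N. of_real (ln (real (N * q + 1)) - ln (real N))
      - (1 / z - 1) * (\<Sum>r<q. z ^ (r + 1) * of_real (g (r + 1) N))) \<longlonglongrightarrow>
      of_real (ln (real q)) - (1 / z - 1) * (\<Sum>r<q. z ^ (r + 1) * of_real (ln (Gamma (real (r + 1) / real q))))"
  proof -
    have "(\<lambda>N. ln (real N * real q + 1) - ln (real N)) \<longlonglongrightarrow> ln (real q)"
      using q by real_asymp
    then have "(\<lambda>N. ln (real (N * q + 1)) - ln (real N)) \<longlonglongrightarrow> ln (real q)"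
      by (simp add: add.commute)
    then show ?thesis
      by (intro tendsto_intros g_lim) auto
  qed
  ultimately have "z * log_mean_transform z = of_real (ln (real q))
      - (1 / z - 1) * (\<Sum>r<q. z ^ (r + 1) * of_real (ln (Gamma (real (r + 1) / real q))))"
    by (rule LIMSEQ_unique)
  \<comment> \<open>After the shift the index runs from \<open>1\<close> to \<open>q\<close>; the
    term at \<open>q\<close> drops out because \<open>ln (Gamma 1) = 0\<close>.\<close>
  also have "(\<Sum>r<q. z ^ (r + 1) * of_real (ln (Gamma (real (r + 1) / real q))))
      = (\<Sum>r=1..<q. z ^ r * of_real (ln (Gamma (real r / real q))))"
  proof -
    obtain m where m: "q = Suc m"
      using q not0_implies_Suc by blast
    define f where "f = (\<lambda>r. z ^ r * of_real (ln (Gamma (real r / real q))))"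
    have "(\<Sum>r<q. f (r + 1)) = (\<Sum>r<m. f (r + 1)) + f q"
      by (simp add: m)
    also have "(\<Sum>r<m. f (r + 1)) = (\<Sum>r=1..<q. f r)"
      unfolding m by (rule sum.reindex_bij_witness[of _ "\<lambda>r. r - 1" Suc]) auto
    also have "f q = 0"
      using q by (simp add: f_def)
    finally show ?thesis
      by (simp add: f_def)
  qed
  finally show ?thesis .
qed

section \<open>Gauss's formula for the digamma function at rational points\<close>

lemma exp_root_of_unity_power:
  assumes "q > 0"
  shows "exp (2 * pi * \<i> * of_int d / of_nat q) ^ q = 1"
proof -
  have "exp (2 * pi * \<i> * of_int d / of_nat q) ^ q = exp (2 * of_int d * pi * \<i>)"
    using assms by (simp add: mult_ac flip: exp_of_nat_mult)
  then show ?thesis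
    by (simp only: exp_integer_2pi Ints_of_int)
qed

lemma exp_root_of_unity_eq_1_iff:
  assumes "q > 0"
  shows "exp (2 * pi * \<i> * of_int d / of_nat q) = 1 \<longleftrightarrow> int q dvd d"
proof
  assume "exp (2 * pi * \<i> * of_int d / of_nat q) = 1"
  then obtain n :: int where "2 * pi * of_int d / of_nat q = of_int (2 * n) * pi"
    by (auto simp: exp_eq_1)
  then have "real_of_int d = of_int n * real q"
    using assms by (simp add: field_simps)
  then have "d = n * int q"
    by (metis of_int_eq_iff of_int_mult of_int_of_nat_eq)
  then show "int q dvd d"
    by simp
next
  assume "int q dvd d"
  then obtain n where "d = int q * n" ..
  then have "2 * pi * \<i> * of_int d / of_nat q = 2 * of_int n * pi * \<i>"
    using assms by simp
  then show "exp (2 * pi * \<i> * of_int d / of_nat q) = 1"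
    by (simp only: exp_integer_2pi Ints_of_int)
qed

text \<open>Orthogonality of the characters modulo \<open>q\<close>. The term \<open>r = 0\<close>
  is left out, which accounts for the \<open>-1\<close>; the bound on \<open>d\<close> ensures that
  \<open>q\<close> divides \<open>d\<close> only when \<open>d = 0\<close>.\<close>

lemma sum_exp_root_of_unity:
  fixes d :: int
  assumes "\<bar>d\<bar> < int q"
  shows "(\<Sum>r=1..<q. exp (2 * pi * \<i> * of_int d * of_nat r / of_nat q)) = (if d = 0 then of_nat q else 0) - 1"
proof -
  define u where "u = exp (2 * pi * \<i> * of_int d / of_nat q)"
  have q: "q > 0"
    using assms by auto
  have u: "exp (2 * pi * \<i> * of_int d * of_nat r / of_nat q) = u ^ r" for r
    by (simp add: u_def mult_ac flip: exp_of_nat_mult)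
  have uq: "u ^ q = 1"
    unfolding u_def by (rule exp_root_of_unity_power[OF q])
  have split: "(\<Sum>r<q. u ^ r) = 1 + (\<Sum>r=1..<q. u ^ r)"
    using q by (simp add: sum.atLeast_Suc_lessThan atLeast0LessThan[symmetric])
  show ?thesis
  proof (cases "d = 0")
    case True
    with q show ?thesis
      by (simp add: of_nat_diff)
  next
    case False
    have "\<not> int q dvd d"
      using assms False dvd_imp_le_int[of d "int q"] by auto
    then have "u \<noteq> 1"
      unfolding u_def exp_root_of_unity_eq_1_iff[OF q] .
    then have "(\<Sum>r<q. u ^ r) = 0"
      using uq by (rule sum_root_of_unity[rotated])
    with False split show ?thesis
      unfolding u by (simp add: eq_neg_iff_add_eq_0 add.commute)
  qed
qed

text \<open>Expand every logarithm into its series on the unit circle. Orthogonality in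
  \<open>r\<close> singles out the indices congruent to \<open>p\<close>, which form the partial
  sums of the digamma limit, and subtracts a full harmonic sum, which contributes Euler's constant
  and \<open>ln q\<close>.\<close>

lemma Digamma_rational:
  assumes p: "0 < p" "p < q"
  shows "Digamma (of_real (real p / real q)) + euler_mascheroni + of_real (ln (real q))
    = (\<Sum>r=1..<q. exp (2 * pi * \<i> * of_nat p / of_nat q) ^ r * Ln (1 - exp (- (2 * pi * \<i> * of_nat r / of_nat q))))"
proof -
  define z where "z = exp (2 * pi * \<i> * of_nat p / of_nat q)"
  define y where "y = (\<lambda>r. exp (- (2 * pi * \<i> * of_nat r / of_nat q)))"
  have q: "q > 0" using p by simp
  have y_eq: "y r = exp (2 * pi * \<i> * of_int (- int r) / of_nat q)" for r
    by (simp add: y_def)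
  have y_q: "y r ^ q = 1" for r
    unfolding y_eq by (rule exp_root_of_unity_power[OF q])
  have y_ne: "y r \<noteq> 1" if "r \<in> {1..<q}" for r
  proof -
    have "\<not> int q dvd int r"
      using that by (auto dest: dvd_imp_le)
    then show ?thesis
      unfolding y_eq exp_root_of_unity_eq_1_iff[OF q] by simp
  qed
  have y_norm: "norm (y r) = 1" for r
    using power_eq_imp_eq_norm[of "y r" q 1] y_q q by simp
  have zy: "(\<Sum>r=1..<q. z ^ r * y r ^ (j + 1)) = (if j + 1 = p then of_nat q else 0) - 1" if "j < q" for j
  proof -
    \<comment> \<open>The product is the character of \<open>p - (j + 1)\<close>, a difference
      smaller than \<open>q\<close> in absolute value.\<close>
    have "z ^ r * y r ^ (j + 1) = exp (2 * pi * \<i> * of_int (int p - int (j + 1)) * of_nat r / of_nat q)" for r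
      unfolding z_def y_def exp_of_nat_mult[symmetric] mult_exp_exp
      by (rule arg_cong[of _ _ exp]) (use q in \<open>simp add: field_simps\<close>)
    then show ?thesis
      using sum_exp_root_of_unity[of "int p - int (j + 1)" q] p that by (auto simp del: of_nat_Suc)
  qed
  have partial: "(\<Sum>r=1..<q. z ^ r * (\<Sum>n<N * q. y r ^ (n + 1) / of_nat (n + 1)))
      = (\<Sum>k<N. inverse (of_real (real p / real q) + of_nat k)) - of_real (harm (N * q))" for N
  proof -
    have "(\<Sum>r=1..<q. z ^ r * (\<Sum>n<N * q. y r ^ (n + 1) / of_nat (n + 1)))
        = (\<Sum>n<N * q. (\<Sum>r=1..<q. z ^ r * y r ^ (n + 1)) / of_nat (n + 1))"
      unfolding sum_distrib_left sum_divide_distrib by (subst sum.swap) simp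
    also have "\<dots> = (\<Sum>j<q. \<Sum>k<N. (\<Sum>r=1..<q. z ^ r * y r ^ (j + 1)) / of_nat (k * q + j + 1))"
      unfolding sum_lessThan_mult_residues
      by (intro sum.cong refl) (simp add: power_add power_mult y_q mult.commute[of _ q])
    also have "\<dots> = (\<Sum>j<q. \<Sum>k<N. (if j = p - 1 then of_nat q / of_nat (k * q + p) else 0) - 1 / of_nat (k * q + j + 1))"
    proof (intro sum.cong refl)
      fix j k assume "j \<in> {..<q}"
      then show "(\<Sum>r=1..<q. z ^ r * y r ^ (j + 1)) / of_nat (k * q + j + 1)
          = (if j = p - 1 then of_nat q / of_nat (k * q + p) else 0) - 1 / of_nat (k * q + j + 1)"
        using p by (subst zy) (auto simp: diff_divide_distrib)
    qed
    also have "\<dots> = (\<Sum>j<q. if j = p - 1 then \<Sum>k<N. of_nat q / of_nat (k * q + p) else 0)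
        - (\<Sum>n<N * q. 1 / of_nat (n + 1))"
      unfolding sum_lessThan_mult_residues sum_subtractf
      by (intro arg_cong2[of _ _ _ _ minus] sum.cong refl) auto
    \<comment> \<open>Only \<open>j = p - 1\<close> survives, and \<open>q / (k * q + p)\<close> is
      the reciprocal of \<open>p / q + k\<close>.\<close>
    also have "(\<Sum>j<q. if j = p - 1 then \<Sum>k<N. of_nat q / of_nat (k * q + p) else 0)
        = (\<Sum>k<N. inverse (of_real (real p / real q) + of_nat k :: complex))"
      using p by (simp add: sum.delta field_simps)
    also have "(\<Sum>n<N * q. 1 / of_nat (n + 1)) = complex_of_real (harm (N * q))"
      by (simp add: harm_def sum.atLeast1_atMost_eq field_simps)
    finally show ?thesis .
  qed
  have "(\<lambda>N. \<Sum>n<N * q. y r ^ (n + 1) / of_nat (n + 1)) \<longlonglongrightarrow> - Ln (1 - y r)" if "r \<in> {1..<q}" for r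
    using LIMSEQ_subseq_LIMSEQ[OF Ln_one_minus_sums[of "y r", unfolded sums_def] strict_mono_mult_right[OF q]]
      y_norm y_ne[OF that] by (simp add: o_def)
  then have "(\<lambda>N. \<Sum>r=1..<q. z ^ r * (\<Sum>n<N * q. y r ^ (n + 1) / of_nat (n + 1)))
      \<longlonglongrightarrow> (\<Sum>r=1..<q. z ^ r * - Ln (1 - y r))"
    by (intro tendsto_sum tendsto_mult_left)
  then have 1: "(\<lambda>N. (\<Sum>k<N. inverse (of_real (real p / real q) + of_nat k)) - of_real (harm (N * q)))
      \<longlonglongrightarrow> (\<Sum>r=1..<q. z ^ r * - Ln (1 - y r))"
    unfolding partial .
  have "(\<lambda>N. of_real (ln (real N)) - (\<Sum>k<N. inverse (of_real (real p / real q) + of_nat k)))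
      \<longlonglongrightarrow> Digamma (complex_of_real (real p / real q))"
    using p by (intro Digamma_LIMSEQ) simp
  moreover have "(\<lambda>N. complex_of_real (harm (N * q) - ln (real (N * q)))) \<longlonglongrightarrow> euler_mascheroni"
    using LIMSEQ_subseq_LIMSEQ[OF euler_mascheroni_LIMSEQ_of_real strict_mono_mult_right[OF q]]
    by (simp add: o_def)
  \<comment> \<open>The logarithms cancel for \<open>N > 0\<close>, since
    \<open>ln (N * q) = ln N + ln q\<close>.\<close>
  ultimately have "(\<lambda>N. - (of_real (ln (real N)) - (\<Sum>k<N. inverse (of_real (real p / real q) + of_nat k)))
      - complex_of_real (harm (N * q) - ln (real (N * q))) - of_real (ln (real q)))
      \<longlonglongrightarrow> - Digamma (complex_of_real (real p / real q)) - euler_mascheroni - of_real (ln (real q))"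
    by (intro tendsto_intros)
  moreover have "eventually (\<lambda>N. - (of_real (ln (real N)) - (\<Sum>k<N. inverse (of_real (real p / real q) + of_nat k)))
      - complex_of_real (harm (N * q) - ln (real (N * q))) - of_real (ln (real q))
      = (\<Sum>k<N. inverse (of_real (real p / real q) + of_nat k)) - of_real (harm (N * q))) sequentially"
    using eventually_gt_at_top[of 0] by eventually_elim (use q in \<open>simp add: ln_mult\<close>)
  ultimately have "(\<lambda>N. (\<Sum>k<N. inverse (of_real (real p / real q) + of_nat k)) - of_real (harm (N * q)))
      \<longlonglongrightarrow> - Digamma (complex_of_real (real p / real q)) - euler_mascheroni - of_real (ln (real q))"
    by (rule Lim_transform_eventually)
  from LIMSEQ_unique[OF 1 this]
  have "(\<Sum>r=1..<q. z ^ r * Ln (1 - y r)) = Digamma (complex_of_real (real p / real q)) + euler_mascheroni + of_real (ln (real q))"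
    by (simp add: sum_negf algebra_simps)
  then show ?thesis
    by (simp add: z_def y_def)
qed

text \<open>Polar form of a chord of the unit circle: its length is \<open>2 * sin (t / 2)\<close>,
  and its angle \<open>(pi - t) / 2\<close> lies strictly between \<open>- pi / 2\<close> and
  \<open>pi / 2\<close>, so it is the principal argument.\<close>

lemma Ln_one_minus_exp:
  assumes "0 < t" "t < 2 * pi"
  shows "Ln (1 - exp (- (\<i> * of_real t))) = of_real (ln (2 * sin (t / 2))) + \<i> * of_real ((pi - t) / 2)"
proof (rule Ln_unique)
  have s: "sin (t / 2) > 0"
    using assms by (intro sin_gt_zero) auto
  have ct: "cos t = 1 - 2 * (sin (t / 2))\<^sup>2" and st: "sin t = 2 * sin (t / 2) * cos (t / 2)"
    using cos_double_sin[of "t / 2"] sin_double[of "t / 2"] by simp_all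
  have "exp (of_real (ln (2 * sin (t / 2))) + \<i> * of_real ((pi - t) / 2))
      = of_real (2 * sin (t / 2)) * cis (pi / 2 - t / 2)"
    using s by (simp add: exp_add cis_conv_exp exp_of_real diff_divide_distrib)
  also have "\<dots> = 1 - cis (- t)"
    by (simp add: complex_eq_iff cos_diff sin_diff ct st power2_eq_square)
  finally show "exp (of_real (ln (2 * sin (t / 2))) + \<i> * of_real ((pi - t) / 2)) = 1 - exp (- (\<i> * of_real t))"
    by (simp add: cis_conv_exp)
qed (use assms in auto)

text \<open>The left-hand side is weighted so that the two Gamma sums \<open>A\<close> and
  \<open>B\<close> enter only through \<open>A + B\<close>. Reflection turns \<open>A + B\<close>
  into the sine sum \<open>F\<close>, which Gauss's formula also contains, and \<open>ln q\<close>
  cancels.\<close>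

lemma log_mean_transform_reflection_rational:
  assumes p: "0 < p" "p < q" and z: "z = exp (2 * pi * \<i> * of_nat p / of_nat q)"
  shows "z\<^sup>2 * log_mean_transform z - log_mean_transform (1 / z) / z
    = - pi * \<i> + (1 - z) * (euler_mascheroni + of_real (ln (2 * pi)) + pi * \<i> / 2
                              + Digamma (of_real (real p / real q)))"
proof -
  have q: "q > 0" using p by simp
  have z': "z = exp (2 * pi * \<i> * of_int (int p) / of_nat q)"
    by (simp add: z)
  have zq: "z ^ q = 1"
    unfolding z' by (rule exp_root_of_unity_power[OF q])
  have z1: "z \<noteq> 1"
    unfolding z' exp_root_of_unity_eq_1_iff[OF q] using p by (auto dest: dvd_imp_le)
  have z0: "z \<noteq> 0"
    by (simp add: z)
  define A where "A = (\<Sum>r=1..<q. z ^ r * of_real (ln (Gamma (real r / real q))))"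
  define B where "B = (\<Sum>r=1..<q. (1 / z) ^ r * of_real (ln (Gamma (real r / real q))))"
  define F where "F = (\<Sum>r=1..<q. z ^ r * of_real (ln (2 * sin (pi * real r / real q))))"
  have range: "{..<q} = insert 0 {1..<q}"
    using q by auto
  have sum0: "(\<Sum>r=1..<q. z ^ r) = - 1"
    using sum_root_of_unity[OF zq z1] unfolding range by (simp add: eq_neg_iff_add_eq_0 add.commute)
  have sum1: "(\<Sum>r=1..<q. of_nat r * z ^ r) = of_nat q / (z - 1)"
    using sum_index_root_of_unity[OF zq z1] unfolding range by simp
  have sin_pos: "sin (pi * real r / real q) > 0" if "r \<in> {1..<q}" for r
    using that q by (intro sin_gt_zero) (auto simp: field_simps)
  have AB: "A + B = - of_real (ln (2 * pi)) - F"
  proof -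
    \<comment> \<open>Replacing \<open>r\<close> by \<open>q - r\<close> changes the powers of
      \<open>1 / z\<close> into powers of \<open>z\<close> and prepares the reflection
      formula.\<close>
    have "B = (\<Sum>r=1..<q. z ^ r * of_real (ln (Gamma (1 - real r / real q))))"
      unfolding B_def
    proof (rule sum.reindex_bij_witness[of _ "\<lambda>r. q - r" "\<lambda>r. q - r"])
      fix r assume r: "r \<in> {1..<q}"
      have "z ^ (q - r) * z ^ r = 1"
        using r zq by (simp flip: power_add)
      then have "z ^ (q - r) = (1 / z) ^ r"
        using z0 by (simp add: field_simps)
      moreover have "1 - real (q - r) / real q = real r / real q"
        using r by (simp add: of_nat_diff field_simps)
      ultimately show "z ^ (q - r) * of_real (ln (Gamma (1 - real (q - r) / real q)))
          = (1 / z) ^ r * of_real (ln (Gamma (real r / real q)))"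
        by simp
      show "q - r \<in> {1..<q}" "q - (q - r) = r"
        using r by auto
    next
      fix r assume r: "r \<in> {1..<q}"
      then show "q - r \<in> {1..<q}" "q - (q - r) = r"
        by auto
    qed
    then have "A + B = (\<Sum>r=1..<q. z ^ r * of_real (ln (Gamma (real r / real q)) + ln (Gamma (1 - real r / real q))))"
      by (simp add: A_def sum.distrib algebra_simps)
    also have "\<dots> = (\<Sum>r=1..<q. z ^ r * of_real (ln (2 * pi) - ln (2 * sin (pi * real r / real q))))"
    proof (intro sum.cong refl arg_cong2[of _ _ _ _ "(*)"] arg_cong[of _ _ complex_of_real])
      fix r assume r: "r \<in> {1..<q}"
      define x where "x = real r / real q"
      have x: "0 < x" "x < 1"
        using r by (auto simp: x_def)
      have "complex_of_real (Gamma x * Gamma (1 - x)) = Gamma (of_real x) * Gamma (1 - of_real x)"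
        using Gamma_complex_of_real[of x] Gamma_complex_of_real[of "1 - x"] by simp
      also have "\<dots> = of_real (pi / sin (pi * x))"
        unfolding Gamma_reflection_complex by (simp only: sin_of_real of_real_mult[symmetric] of_real_divide)
      finally have "complex_of_real (Gamma x * Gamma (1 - x)) = of_real (pi / sin (pi * x))" .
      then have refl: "Gamma x * Gamma (1 - x) = pi / sin (pi * x)"
        by (simp only: of_real_eq_iff)
      have "Gamma x > 0" "Gamma (1 - x) > 0"
        using x by (auto intro!: Gamma_real_pos)
      then have "ln (Gamma x) + ln (Gamma (1 - x)) = ln (pi / sin (pi * x))"
        by (simp add: ln_mult flip: refl)
      \<comment> \<open>The factor 2 is inserted in both logarithms so that the sine terms agree
        with the chord lengths in Gauss's formula.\<close>
      also have "\<dots> = ln (2 * pi) - ln (2 * sin (pi * x))"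
        using sin_pos[OF r] by (simp add: x_def ln_div ln_mult)
      finally show "ln (Gamma (real r / real q)) + ln (Gamma (1 - real r / real q))
          = ln (2 * pi) - ln (2 * sin (pi * real r / real q))"
        by (simp add: x_def)
    qed
    also have "\<dots> = of_real (ln (2 * pi)) * (\<Sum>r=1..<q. z ^ r) - F"
      unfolding F_def sum_distrib_left sum_subtractf[symmetric]
      by (intro sum.cong refl) (simp add: algebra_simps)
    finally show ?thesis
      unfolding sum0 by simp
  qed
  \<comment> \<open>The chord angle is affine in \<open>r\<close>: its constant part meets the sum
    of the powers, equal to \<open>-1\<close>, and its linear part meets the weighted sum, equal to
    \<open>q / (z - 1)\<close>.\<close>
  have psi: "Digamma (of_real (real p / real q)) + euler_mascheroni + of_real (ln (real q))
      = F - pi * \<i> / 2 - pi * \<i> / (z - 1)"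
  proof -
    have "Digamma (of_real (real p / real q)) + euler_mascheroni + of_real (ln (real q))
        = (\<Sum>r=1..<q. z ^ r * (of_real (ln (2 * sin (pi * real r / real q)))
            + pi * \<i> / 2 - pi * \<i> / of_nat q * of_nat r))"
      unfolding Digamma_rational[OF p] z[symmetric]
    proof (intro sum.cong refl arg_cong2[of _ _ _ _ "(*)"])
      fix r assume r: "r \<in> {1..<q}"
      define t where "t = 2 * pi * real r / real q"
      have "0 < t" "t < 2 * pi"
        using r by (auto simp: t_def field_simps)
      from Ln_one_minus_exp[OF this]
      have "Ln (1 - exp (- (\<i> * of_real t)))
          = of_real (ln (2 * sin (pi * real r / real q))) + \<i> * of_real ((pi - t) / 2)"
        by (simp add: t_def)
      moreover have "\<i> * of_real t = 2 * pi * \<i> * of_nat r / of_nat q"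
        by (simp add: t_def)
      moreover have "\<i> * of_real ((pi - t) / 2) = pi * \<i> / 2 - pi * \<i> / of_nat q * of_nat r"
        by (simp add: t_def field_simps)
      ultimately show "Ln (1 - exp (- (2 * pi * \<i> * of_nat r / of_nat q)))
          = of_real (ln (2 * sin (pi * real r / real q))) + pi * \<i> / 2 - pi * \<i> / of_nat q * of_nat r"
        by simp
    qed
    also have "\<dots> = F + pi * \<i> / 2 * (\<Sum>r=1..<q. z ^ r) - pi * \<i> / of_nat q * (\<Sum>r=1..<q. of_nat r * z ^ r)"
      unfolding F_def sum_distrib_left sum_subtractf[symmetric] sum.distrib[symmetric]
      by (intro sum.cong refl) (simp add: algebra_simps)
    finally show ?thesis
      unfolding sum0 sum1 using q by simp
  qed
  have K1: "z * log_mean_transform z = of_real (ln (real q)) - (1 / z - 1) * A"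
    unfolding A_def by (rule log_mean_transform_root_of_unity[OF zq z1 q])
  have K2: "1 / z * log_mean_transform (1 / z) = of_real (ln (real q)) - (1 / (1 / z) - 1) * B"
    unfolding B_def using zq z1 z0 q
    by (intro log_mean_transform_root_of_unity) (auto simp: power_divide)
  have "z\<^sup>2 * log_mean_transform z - log_mean_transform (1 / z) / z
      = z * (z * log_mean_transform z) - 1 / z * log_mean_transform (1 / z)"
    by (simp add: power2_eq_square)
  also have "\<dots> = (1 - z) * (- of_real (ln (real q)) - (A + B))"
    unfolding K1 K2 using z0 by (simp add: field_simps)
  also have "\<dots> = (1 - z) * (of_real (ln (2 * pi)) + (F - of_real (ln (real q))))"
    unfolding AB by simp
  also have "F - of_real (ln (real q))
      = Digamma (of_real (real p / real q)) + euler_mascheroni + pi * \<i> / 2 + pi * \<i> / (z - 1)"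
    using psi by (simp add: algebra_simps)
  also have "(1 - z) * (of_real (ln (2 * pi)) + (Digamma (of_real (real p / real q)) + euler_mascheroni
        + pi * \<i> / 2 + pi * \<i> / (z - 1)))
      = (1 - z) * (pi * \<i> / (z - 1)) + (1 - z) * (euler_mascheroni + of_real (ln (2 * pi)) + pi * \<i> / 2
        + Digamma (of_real (real p / real q)))"
    unfolding distrib_left[symmetric] by (simp add: add_ac)
  \<comment> \<open>The isolated term \<open>- pi * \<i>\<close> of the final formula thus comes
    from the linear part of the chord angles.\<close>
  also have "(1 - z) * (pi * \<i> / (z - 1)) = - pi * \<i>"
    using z1 by (simp add: field_simps)
  finally show ?thesis .
qed

subsection \<open>Extension to the strip\<close>

lemma inverse_notin_slit:
  assumes "z \<notin> complex_of_real ` {0..}"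
  shows "1 / z \<notin> complex_of_real ` {1..}"
proof
  assume "1 / z \<in> complex_of_real ` {1..}"
  then obtain x where x: "x \<ge> 1" "1 / z = of_real x"
    by auto
  have "z = 1 / (1 / z)"
    by simp
  also have "\<dots> = of_real (1 / x)"
    by (simp add: x(2))
  finally have "z = of_real (1 / x)" .
  moreover have "1 / x \<ge> 0"
    using x(1) by simp
  ultimately show False
    using assms by (metis atLeast_iff image_eqI)
qed

lemma exp_strip_not_nonneg_Reals:
  assumes "0 < Re w" "Re w < 1"
  shows "exp (2 * pi * \<i> * w) \<notin> complex_of_real ` {0..}"
proof
  assume "exp (2 * pi * \<i> * w) \<in> complex_of_real ` {0..}"
  then obtain x where x: "x \<ge> 0" "exp (2 * pi * \<i> * w) = of_real x"
    by auto
  then have "x \<noteq> 0"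
    by (metis exp_not_eq_zero of_real_0)
  with x have "exp (2 * pi * \<i> * w) = exp (of_real (ln x))"
    by (simp add: exp_of_real)
  then obtain n :: int where "2 * pi * \<i> * w = of_real (ln x) + of_int (2 * n) * pi * \<i>"
    by (auto simp: exp_eq)
  then have "Im (2 * pi * \<i> * w) = Im (of_real (ln x) + of_int (2 * n) * pi * \<i>)"
    by simp
  then have "Re w = of_int n"
    by simp
  with assms show False
    by simp
qed

text \<open>The difference \<open>D\<close> of the two sides is holomorphic on the connected strip
  \<open>S\<close>: there \<open>e w\<close> and its reciprocal avoid the slit, and \<open>w\<close>
  avoids the poles of \<open>Digamma\<close>. So zeros accumulating at one interior point
  suffice.\<close>

lemma log_mean_transform_reflection:
  assumes w: "0 < Re w" "Re w < 1" and z: "z = exp (2 * pi * \<i> * w)"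
  shows "z\<^sup>2 * log_mean_transform z - log_mean_transform (1 / z) / z
    = - pi * \<i> + (1 - z) * (euler_mascheroni + of_real (ln (2 * pi)) + pi * \<i> / 2 + Digamma w)"
proof -
  define S where "S = {w. 0 < Re w \<and> Re w < 1}"
  define e where "e = (\<lambda>w. exp (2 * pi * \<i> * w))"
  define D where "D = (\<lambda>w. (e w)\<^sup>2 * log_mean_transform (e w) - log_mean_transform (1 / e w) / e w
    - (- pi * \<i> + (1 - e w) * (euler_mascheroni + of_real (ln (2 * pi)) + pi * \<i> / 2 + Digamma w)))"
  \<comment> \<open>Rationals \<open>p / q\<close> with \<open>p = n + 1\<close> and
    \<open>q = 2 * n + 3\<close>: they stay strictly below \<open>1 / 2\<close> and converge to it,
    so the limit point is inside the strip.\<close>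
  define U where "U = (\<lambda>n. complex_of_real (real (n + 1) / real (2 * n + 3))) ` UNIV"
  have e_slit: "e w \<notin> complex_of_real ` {1..}" "1 / e w \<notin> complex_of_real ` {1..}" if "w \<in> S" for w
  proof -
    have *: "e w \<notin> complex_of_real ` {0..}"
      using exp_strip_not_nonneg_Reals that by (simp add: S_def e_def)
    then show "e w \<notin> complex_of_real ` {1..}"
      by auto
    show "1 / e w \<notin> complex_of_real ` {1..}"
      by (rule inverse_notin_slit[OF *])
  qed
  have "S = {w. 0 < Re w} \<inter> {w. Re w < 1}"
    by (auto simp: S_def)
  then have S: "open S" "connected S"
    by (auto intro!: open_Int open_halfspace_Re_gt open_halfspace_Re_lt convex_connected
        convex_Int convex_halfspace_Re_gt convex_halfspace_Re_lt)
  have holo: "log_mean_transform \<circ> f holomorphic_on S"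
    if "f holomorphic_on S" "\<And>w. w \<in> S \<Longrightarrow> f w \<notin> complex_of_real ` {1..}" for f
    using that by (intro holomorphic_on_compose_gen[OF _ holomorphic_on_log_mean_transform]) auto
  have "e holomorphic_on S" "(\<lambda>w. 1 / e w) holomorphic_on S"
    unfolding e_def by (intro holomorphic_intros; simp)+
  then have "(\<lambda>w. log_mean_transform (e w)) holomorphic_on S"
    "(\<lambda>w. log_mean_transform (1 / e w)) holomorphic_on S"
    using holo e_slit unfolding o_def by blast+
  moreover have "S \<inter> \<int>\<^sub>\<le>\<^sub>0 = {}"
    by (auto simp: S_def elim!: nonpos_Ints_cases)
  ultimately have "D holomorphic_on S"
    unfolding D_def by (intro holomorphic_intros) (auto simp: e_def[abs_def] intro!: holomorphic_intros)
  moreover have "U \<subseteq> S"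
    by (auto simp: U_def S_def field_simps)
  moreover have "1 / 2 \<in> S"
    by (simp add: S_def)
  moreover have "1 / 2 islimpt U"
  proof -
    have "(\<lambda>n. real (n + 1) / real (2 * n + 3)) \<longlonglongrightarrow> 1 / 2"
      by real_asymp
    then have "(\<lambda>n. complex_of_real (real (n + 1) / real (2 * n + 3))) \<longlonglongrightarrow> of_real (1 / 2)"
      by (rule tendsto_of_real)
    moreover have "complex_of_real (real (n + 1) / real (2 * n + 3)) \<in> U - {1 / 2}" for n
    proof -
      have "real (n + 1) / real (2 * n + 3) \<noteq> 1 / 2"
        by (simp add: field_simps)
      then have "complex_of_real (real (n + 1) / real (2 * n + 3)) \<noteq> complex_of_real (1 / 2)"
        unfolding of_real_eq_iff .
      then show ?thesis
        by (auto simp: U_def)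
    qed
    ultimately show ?thesis
      unfolding islimpt_sequential by (intro exI[of _ "\<lambda>n. complex_of_real (real (n + 1) / real (2 * n + 3))"]) simp
  qed
  moreover have "D u = 0" if u_U: "u \<in> U" for u
  proof -
    obtain n where u: "u = complex_of_real (real (n + 1) / real (2 * n + 3))"
      using u_U unfolding U_def by blast
    have "e u = exp (2 * pi * \<i> * of_nat (n + 1) / of_nat (2 * n + 3))"
      by (simp add: e_def u)
    from log_mean_transform_reflection_rational[OF _ _ this, folded u] show ?thesis
      by (simp add: D_def)
  qed
  moreover have "w \<in> S"
    using w by (simp add: S_def)
  ultimately have "D w = 0"
    using analytic_continuation[OF _ S, of D U "1 / 2" w] by blast
  then show ?thesis
    by (simp add: D_def e_def z)
qed

section \<open>Return from the transform to the generalized Euler function\<close>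

theorem theorem12:
  fixes z :: complex
  assumes "z \<notin> complex_of_real ` {0..}" and "Im z \<ge> 0"
  shows "gen_euler (1 / z) =
           z ^ 3 * gen_euler z - pi * \<i> * z + z ^ 2 * Ln (1 - z) - z * Ln ((z - 1) / z)
           + z * (1 - z) * (of_real euler_mascheroni + of_real (ln (2 * pi)) + pi * \<i> / 2
                            + Digamma (Ln z / (2 * pi * \<i>)))"
proof -
  define w where "w = Ln z / (2 * pi * \<i>)"
  have z0: "z \<noteq> 0"
    using assms(1) by auto
  have ez: "z = exp (2 * pi * \<i> * w)"
    using z0 by (simp add: w_def)
  have Re_w: "Re w = Im (Ln z) / (2 * pi)"
    by (simp add: w_def Re_divide power2_eq_square)
  have "Im (Ln z) \<noteq> 0"
  proof
    assume "Im (Ln z) = 0"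
    then have "Ln z = of_real (Re (Ln z))"
      by (simp add: complex_eq_iff)
    then have "z = of_real (exp (Re (Ln z)))"
      using z0 by (metis exp_Ln exp_of_real)
    with assms(1) show False
      by (metis atLeast_iff exp_ge_zero image_eqI)
  qed
  \<comment> \<open>Here \<open>Im z \<ge> 0\<close> enters: a negative argument would give
    \<open>w\<close> a negative real part, outside the strip.\<close>
  moreover have "0 \<le> Im (Ln z)" "Im (Ln z) \<le> pi"
    using Im_Ln_pos_le[OF z0] assms(2) by auto
  ultimately have "0 < Im (Ln z)" "Im (Ln z) \<le> pi"
    by auto
  then have w: "0 < Re w" "Re w < 1"
    unfolding Re_w using pi_gt_zero by (auto simp: field_simps)
  have slit: "z \<notin> complex_of_real ` {1..}"
    using assms(1) by auto
  have "gen_euler (1 / z) = z * (1 / z * gen_euler (1 / z))"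
    using z0 by simp
  also have "\<dots> = - z * Ln (1 - 1 / z) - log_mean_transform (1 / z)"
    unfolding gen_euler_conv_log_mean_transform[OF inverse_notin_slit[OF assms(1)]]
    using z0 by (simp add: right_diff_distrib)
  also have "1 - 1 / z = (z - 1) / z"
    using z0 by (simp add: diff_divide_distrib)
  finally have 1: "gen_euler (1 / z) = - z * Ln ((z - 1) / z) - log_mean_transform (1 / z)" .
  have 2: "z ^ 3 * gen_euler z = - z\<^sup>2 * Ln (1 - z) - z ^ 3 * log_mean_transform z"
  proof -
    have "z ^ 3 * gen_euler z = z\<^sup>2 * (z * gen_euler z)"
      by (simp add: power2_eq_square power3_eq_cube)
    then show ?thesis
      unfolding gen_euler_conv_log_mean_transform[OF slit]
      by (simp add: power2_eq_square power3_eq_cube algebra_simps)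
  qed
  \<comment> \<open>The logarithms in \<open>1\<close> and \<open>2\<close> are exactly those of the
    claim, so only the two transforms remain to be compared.\<close>
  have "z ^ 3 * log_mean_transform z - log_mean_transform (1 / z)
      = z * (z\<^sup>2 * log_mean_transform z - log_mean_transform (1 / z) / z)"
    using z0 by (simp add: power2_eq_square power3_eq_cube field_simps)
  also have "\<dots> = z * (- pi * \<i> + (1 - z) * (euler_mascheroni + of_real (ln (2 * pi)) + pi * \<i> / 2 + Digamma w))"
    unfolding log_mean_transform_reflection[OF w ez] ..
  finally have "log_mean_transform (1 / z) = z ^ 3 * log_mean_transform z
      - z * (- pi * \<i> + (1 - z) * (euler_mascheroni + of_real (ln (2 * pi)) + pi * \<i> / 2 + Digamma w))"
    by (simp add: algebra_simps)
  then show ?thesis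
    unfolding 1 2 by (simp add: algebra_simps w_def)
qed

end
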